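(* For every integer $m\ge 1$, the $m$th binomial permutation moment $\overline{\mu}_m$ is pattern-finite, expanding as $$\overline{\mu}_m=\sum_{\substack{p,q\in\mathcal{S}\\ |p|+|q|\le m}}\overline{\kappa}(m,|p|,|q|)\cdot[q\ominus 1\ominus p],$$ where $$\overline{\kappa}(m,a,b):=\sum_{k=b}^{m-a}(-1)^k\binom{\lceil m/2\rceil-1}{m-a-k}\binom{k-1}{k-b}.$$
   Context: $S_n$ is the set of permutations of $[1,n]=\{1,\dots,n\}$ (with $S_0=\{\varnothing\}$), $\mathcal{S}=\bigsqcup_{n\ge 0}S_n$, and $|w|=n$ for $w\in S_n$. A permutation statistic is a function on $\mathcal{S}$. For $p\in S_k$ and $w\in S_n$, an occurrence of $p$ in $w$ is a choice of indices $1\le i_1<\dots<i_k\le n$ such that $w(i_1)\cdots w(i_k)$ is order isomorphic to $p(1)\cdots p(k)$; the pattern-count function $[p]\colon\mathcal{S}\to\mathbb{N}$ sends $w$ to the number of occurrences of $p$ in $w$ (so $[\varnothing]$ is constantly $1$). Every statistic is uniquely a (possibly infinite) linear combination of pattern-count functions; it is pattern-finite if only finitely many coefficients are nonzero. The $m$th binomial permutation moment is $$\overline{\mu}_m(w)=\sum_{i\ge 1}\binom{w(i)-i+\lceil m/2\rceil-1}{m},$$ where by convention $w(i)=i$ for $i>|w|$. Binomial coefficients $\binom{x}{j}$ with integer (possibly negative) $x$ and integer $j\ge 0$ are $x(x-1)\cdots(x-j+1)/j!$ (in particular $\binom{-1}{0}=1$). For $p\in S_a$ and $q\in S_b$, the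 skew sum $p\ominus q\in S_{a+b}$ is defined by $(p\ominus q)(i)=b+p(i)$ for $1\le i\le a$ and $(p\ominus q)(i)=q(i-a)$ for $a+1\le i\le a+b$. Here $1$ denotes the unique element of $S_1$. *)

theory Defs
  imports Complex_Main "HOL-Combinatorics.Multiset_Permutations"
begin

text \<open>
  A permutation of \<open>{1..n}\<close> is the list of its values in one-line notation, so \<open>|w|\<close> is
  \<open>length w\<close> and a permutation statistic is a function on lists of which only the values
  on \<open>perms\<close> matter.
\<close>

definition perms :: "nat list set" where
  "perms = (\<Union>n. permutations_of_set {1..n})"

text \<open>The value \<open>w(i)\<close>, with positions counted from 1 and \<open>w(i) = i\<close> for \<open>i > |w|\<close>.\<close>

definition perm_at :: "nat list \<Rightarrow> nat \<Rightarrow> nat" where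
  "perm_at w i = (if 1 \<le> i \<and> i \<le> length w then w ! (i - 1) else i)"

definition order_isomorphic :: "nat list \<Rightarrow> nat list \<Rightarrow> bool" where
  "order_isomorphic u v \<longleftrightarrow> length u = length v \<and>
     (\<forall>i < length u. \<forall>j < length u. u ! i < u ! j \<longleftrightarrow> v ! i < v ! j)"

definition occurrences :: "nat list \<Rightarrow> nat list \<Rightarrow> nat list set" where
  "occurrences p w =
     {is. sorted_wrt (<) is \<and> set is \<subseteq> {1..length w} \<and> order_isomorphic (map (perm_at w) is) p}"

definition pattern_count :: "nat list \<Rightarrow> nat list \<Rightarrow> nat" where
  "pattern_count p w = card (occurrences p w)"

text \<open>
  \<open>f = (\<Sum>p. c p * [p])\<close> as a possibly infinite linear combination. It is evaluated pointwise:
  \<open>[p](w) = 0\<close> whenever \<open>|p| > |w|\<close>, so only patterns with \<open>|p| \<le> |w|\<close> contribute at \<open>w\<close>.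
\<close>

definition pattern_expansion :: "(nat list \<Rightarrow> 'a::field_char_0) \<Rightarrow> (nat list \<Rightarrow> 'a) \<Rightarrow> bool" where
  "pattern_expansion c f \<longleftrightarrow>
     (\<forall>w \<in> perms. f w = (\<Sum>p | p \<in> perms \<and> length p \<le> length w. c p * of_nat (pattern_count p w)))"

definition pattern_finite :: "(nat list \<Rightarrow> 'a::field_char_0) \<Rightarrow> bool" where
  "pattern_finite f \<longleftrightarrow> (\<exists>c. pattern_expansion c f \<and> finite {p \<in> perms. c p \<noteq> 0})"

definition skew_sum :: "nat list \<Rightarrow> nat list \<Rightarrow> nat list"  (infixl "\<ominus>" 65) where
  "p \<ominus> q = map (\<lambda>x. length q + x) p @ q"

definition moment_term :: "nat \<Rightarrow> nat list \<Rightarrow> nat \<Rightarrow> rat" where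
  "moment_term m w i = rat_of_int (int (perm_at w i) - int i + \<lceil>real m / 2\<rceil> - 1) gchoose m"

text \<open>
  The sum over all \<open>i \<ge> 1\<close> is taken over the support of the summand, which for \<open>m \<ge> 1\<close> is
  finite by the lemma below. (For \<open>m = 0\<close> the sum diverges, and the value 0 here is a
  meaningless default.)
\<close>

definition binomial_moment :: "nat \<Rightarrow> nat list \<Rightarrow> rat" where
  "binomial_moment m w = (\<Sum>i | 1 \<le> i \<and> moment_term m w i \<noteq> 0. moment_term m w i)"

lemma finite_support_moment_term:
  assumes "1 \<le> m"
  shows "finite {i. 1 \<le> i \<and> moment_term m w i \<noteq> 0}"
proof (rule finite_subset)
  have "moment_term m w i = 0" if "length w < i" for i
  proof -
    have "\<exists>k::nat. \<lceil>real m / 2\<rceil> - 1 = int k \<and> k < m"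
      using assms by (intro exI[of _ "nat (\<lceil>real m / 2\<rceil> - 1)"]) linarith
    then obtain k where "\<lceil>real m / 2\<rceil> - 1 = int k" "k < m" by blast
    moreover have "rat_of_nat k gchoose m = 0"
      using \<open>k < m\<close> by (simp flip: binomial_gbinomial)
    ultimately show ?thesis
      using that by (simp add: moment_term_def perm_at_def)
  qed
  then show "{i. 1 \<le> i \<and> moment_term m w i \<noteq> 0} \<subseteq> {1..length w}"
    by (force simp: not_less[symmetric])
qed simp

text \<open>
  The range \<open>k = b, \<dots>, m - a\<close> is spelled out additively so that it is empty for \<open>a + b > m\<close>
  instead of being affected by truncated subtraction. The upper index \<open>int k - 1\<close> is \<open>-1\<close> for
  \<open>k = 0\<close>.
\<close>

definition kappa :: "nat \<Rightarrow> nat \<Rightarrow> nat \<Rightarrow> rat" where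
  "kappa m a b =
     (\<Sum>k | b \<le> k \<and> k + a \<le> m.
        (-1) ^ k * (rat_of_int (\<lceil>real m / 2\<rceil> - 1) gchoose (m - a - k)) *
          (rat_of_int (int k - 1) gchoose (k - b)))"

end

theory Submission
  imports Defs "HOL-Computational_Algebra.Formal_Power_Series"
begin

text \<open>
  Fix \<open>w\<close> and a position \<open>i\<close>, and let \<open>A\<close> be the number of larger values to the left of
  \<open>w(i)\<close> and \<open>B\<close> the number of smaller values to its right. Counting the smaller values and
  the earlier positions shows that \<open>w(i) - i = B - A\<close> (\<open>displacement_eq\<close>). An occurrence of
  \<open>q \<ominus> 1 \<ominus> p\<close> whose middle entry sits at \<open>i\<close> consists of a set counted by \<open>A\<close> that
  spells \<open>q\<close> and a set counted by \<open>B\<close> that spells \<open>p\<close>. Every finite set of positions spells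
  exactly one pattern, so after summing over all \<open>q\<close> of length \<open>b\<close> and all \<open>p\<close> of length \<open>a\<close>
  only the number \<open>(A choose b) * (B choose a)\<close> of choices of the two sets is left
  (\<open>sum_pattern_count_skew\<close>).

  The claim therefore reduces to a polynomial identity in \<open>A\<close> and \<open>B\<close>: the expansion of
  \<open>(B - A + c) gchoose m\<close> in the basis \<open>(B gchoose a) * (A gchoose b)\<close>
  (\<open>gbinomial_diff_expansion\<close>). Vandermonde's identity separates \<open>B\<close>, \<open>-A\<close> and \<open>c\<close>;
  negating the upper index turns \<open>-A gchoose k\<close> into \<open>(A + k - 1) gchoose k\<close> up to sign,
  and a second use of Vandermonde separates \<open>A\<close> from \<open>k - 1\<close>. The coefficients that come out
  are \<open>kappa\<close>.

  The decomposition of a pattern as \<open>q \<ominus> 1 \<ominus> p\<close> is not unique (\<open>321\<close> has three), so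
  the coefficient of a pattern in the resulting finite expansion is a sum over all its
  decompositions.
\<close>

section \<open>Standardization of lists\<close>

lemma perms_iff: "w \<in> perms \<longleftrightarrow> distinct w \<and> set w = {1..length w}"
proof
  assume "w \<in> perms"
  then obtain n where "distinct w" "set w = {1..n}"
    by (auto simp: perms_def permutations_of_set_def)
  then show "distinct w \<and> set w = {1..length w}"
    using distinct_card[of w] by simp
qed (auto simp: perms_def permutations_of_set_def)

lemma mem_permutations_iff:
  "w \<in> permutations_of_set {1..n} \<longleftrightarrow> w \<in> perms \<and> length w = n"
proof
  assume "w \<in> permutations_of_set {1..n}"
  then have "distinct w" "set w = {1..n}"
    by (auto simp: permutations_of_set_def)
  then show "w \<in> perms \<and> length w = n"
    using distinct_card[of w] by (simp add: perms_iff)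
qed (auto simp: permutations_of_set_def perms_iff)

text \<open>
  Ranks are counted by filtering rather than as cardinalities of sets, so that the rank
  function splits over the concatenation of lists.
\<close>

definition std :: "nat list \<Rightarrow> nat list" where
  "std u = map (\<lambda>x. length (filter (\<lambda>z. z \<le> x) u)) u"

lemma length_std [simp]: "length (std u) = length u"
  by (simp add: std_def)

lemma std_singleton [simp]: "std [x] = [1]"
  by (simp add: std_def)

lemma std_nth: "i < length u \<Longrightarrow> std u ! i = card {j. j < length u \<and> u ! j \<le> u ! i}"
  by (simp add: std_def length_filter_conv_card)

lemma order_isomorphic_std: "order_isomorphic u (std u)"
  unfolding order_isomorphic_def
proof (intro conjI allI impI)
  fix i j assume ij: "i < length u" "j < length u"
  let ?S = "\<lambda>i. {k. k < length u \<and> u ! k \<le> u ! i}"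
  show "u ! i < u ! j \<longleftrightarrow> std u ! i < std u ! j"
  proof (cases "u ! i < u ! j")
    case True
    then have "?S i \<subset> ?S j"
      using ij by (auto simp: psubset_eq set_eq_iff intro!: exI[of _ j])
    then have "card (?S i) < card (?S j)"
      by (intro psubset_card_mono) auto
    then show ?thesis using True ij by (simp add: std_nth)
  next
    case False
    then have "card (?S j) \<le> card (?S i)"
      by (intro card_mono) auto
    then show ?thesis using False ij by (simp add: std_nth)
  qed
qed simp

lemma std_cong_order_isomorphic:
  assumes "order_isomorphic u v"
  shows "std u = std v"
proof (rule nth_equalityI)
  show "length (std u) = length (std v)"
    using assms by (simp add: order_isomorphic_def)
  fix i assume "i < length (std u)"
  then have i: "i < length u" "i < length v"
    using assms by (auto simp: order_isomorphic_def)
  have "{j. j < length u \<and> u ! j \<le> u ! i} = {j. j < length v \<and> v ! j \<le> v ! i}"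
    using assms i unfolding order_isomorphic_def not_less[symmetric] by auto
  then show "std u ! i = std v ! i"
    using i by (simp add: std_nth)
qed

lemma std_perm:
  assumes "p \<in> perms"
  shows "std p = p"
proof -
  have d: "distinct p" "set p = {1..length p}" using assms by (auto simp: perms_iff)
  have "length (filter (\<lambda>z. z \<le> x) p) = x" if "x \<in> set p" for x
  proof -
    have "length (filter (\<lambda>z. z \<le> x) p) = card (set (filter (\<lambda>z. z \<le> x) p))"
      using d by (simp only: distinct_card distinct_filter)
    also have "set (filter (\<lambda>z. z \<le> x) p) = {1..x}"
      using d that by auto
    finally show ?thesis by simp
  qed
  then show ?thesis by (simp add: std_def map_idI)
qed

lemma std_in_perms:
  assumes "distinct u"
  shows "std u \<in> perms"
proof -
  have "std u ! i \<noteq> std u ! j" if "i < length u" "j < length u" "i \<noteq> j" for i j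
  proof -
    have "u ! i < u ! j \<or> u ! j < u ! i"
      using assms that by (metis linorder_neqE_nat nth_eq_iff_index_eq)
    then show ?thesis
      using order_isomorphic_std[of u] that by (auto simp: order_isomorphic_def)
  qed
  then have dist: "distinct (std u)"
    by (simp add: distinct_conv_nth)
  have "set (std u) \<subseteq> {1..length u}"
  proof
    fix y assume "y \<in> set (std u)"
    then obtain x where x: "x \<in> set u" "y = length (filter (\<lambda>z. z \<le> x) u)"
      by (auto simp: std_def)
    then have "x \<in> set (filter (\<lambda>z. z \<le> x) u)" by simp
    then have "filter (\<lambda>z. z \<le> x) u \<noteq> []" by force
    then have "1 \<le> y" using x(2) by (simp add: Suc_le_eq)
    then show "y \<in> {1..length u}"
      using x(2) by simp
  qed
  then have "set (std u) = {1..length u}"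
    using distinct_card[OF dist] by (intro card_subset_eq) auto
  then show ?thesis using dist by (simp add: perms_iff)
qed

text \<open>
  Standardization is a complete invariant of order isomorphism and fixes permutations. It
  therefore turns every question about occurrences of a pattern into an equation of lists.
\<close>

lemma order_isomorphic_perm_iff:
  assumes "p \<in> perms"
  shows "order_isomorphic u p \<longleftrightarrow> std u = p"
  using assms order_isomorphic_std std_cong_order_isomorphic std_perm by metis

lemma std_append:
  assumes "\<And>a b. a \<in> set x \<Longrightarrow> b \<in> set y \<Longrightarrow> b < a"
  shows "std (x @ y) = std x \<ominus> std y"
proof -
  \<comment> \<open>Every entry of \<open>y\<close> adds one to the rank of every entry of \<open>x\<close>, and none conversely.\<close>
  have "length (filter (\<lambda>z. z \<le> a) y) = length y" if "a \<in> set x" for a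
    using assms that by (metis filter_True less_imp_le)
  moreover have "filter (\<lambda>z. z \<le> b) x = []" if "b \<in> set y" for b
    using assms that by (fastforce simp: filter_empty_conv not_le)
  ultimately show ?thesis
    by (simp add: std_def skew_sum_def)
qed

section \<open>Occurrences of skew sums\<close>

lemma length_skew_sum [simp]: "length (p \<ominus> q) = length p + length q"
  by (simp add: skew_sum_def)

lemma skew_sum_in_perms:
  assumes "p \<in> perms" "q \<in> perms"
  shows "p \<ominus> q \<in> perms"
proof -
  have d: "distinct p" "set p = {1..length p}" "distinct q" "set q = {1..length q}"
    using assms by (auto simp: perms_iff)
  have im: "(\<lambda>x. length q + x) ` {1..length p} = {length q + 1..length q + length p}"
    by (simp add: image_add_atLeastAtMost)
  show ?thesis
    unfolding perms_iff skew_sum_def using d im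
    by (auto simp: distinct_map inj_on_def)
qed

lemma singleton_in_perms: "[1] \<in> perms"
  by (simp add: perms_iff)

lemma skew_sum_inject:
  assumes "q \<ominus> [1] \<ominus> p = q' \<ominus> [1] \<ominus> p'" "length p = length p'"
  shows "q = q' \<and> p = p'"
proof -
  have inj: "inj (\<lambda>x. k + x)" for k :: nat by (simp add: inj_on_def)
  have "p = p'" "map (\<lambda>x. length p + x) (q \<ominus> [1]) = map (\<lambda>x. length p + x) (q' \<ominus> [1])"
    using assms by (simp_all add: skew_sum_def[where q = p] skew_sum_def[where q = p'])
  then have "q \<ominus> [1] = q' \<ominus> [1]"
    using inj by (simp only: inj_map_eq_map)
  then have "map (\<lambda>x. 1 + x) q = map (\<lambda>x. 1 + x) q'"
    by (simp add: skew_sum_def)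
  then show ?thesis
    using inj \<open>p = p'\<close> by (simp only: inj_map_eq_map)
qed

text \<open>The positions available to \<open>q\<close> and to \<open>p\<close> when the middle entry sits at \<open>i\<close>.\<close>

definition larger_left :: "nat list \<Rightarrow> nat \<Rightarrow> nat set" where
  "larger_left w i = {j \<in> {1..<i}. perm_at w i < perm_at w j}"

definition smaller_right :: "nat list \<Rightarrow> nat \<Rightarrow> nat set" where
  "smaller_right w i = {j \<in> {i<..length w}. perm_at w j < perm_at w i}"

lemma finite_larger_left [simp]: "finite (larger_left w i)"
  and finite_smaller_right [simp]: "finite (smaller_right w i)"
  by (auto simp: larger_left_def smaller_right_def)

definition skew_choices :: "nat list \<Rightarrow> nat \<Rightarrow> nat \<Rightarrow> (nat \<times> nat set \<times> nat set) set" where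
  "skew_choices w b a = (SIGMA i:{1..length w}.
     {X. X \<subseteq> larger_left w i \<and> card X = b} \<times> {Y. Y \<subseteq> smaller_right w i \<and> card Y = a})"

definition index_list :: "nat \<times> nat set \<times> nat set \<Rightarrow> nat list" where
  "index_list = (\<lambda>(i, X, Y). sorted_list_of_set X @ i # sorted_list_of_set Y)"

lemma card_skew_choices:
  "card (skew_choices w b a) =
     (\<Sum>i=1..length w. (card (larger_left w i) choose b) * (card (smaller_right w i) choose a))"
  unfolding skew_choices_def
  by (subst card_SigmaI) (auto simp: card_cartesian_product n_subsets)

lemma inj_index_list: "inj_on index_list (skew_choices w b a)"
proof (rule inj_onI)
  fix s t assume s: "s \<in> skew_choices w b a" and t: "t \<in> skew_choices w b a"
    and eq: "index_list s = index_list t"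
  obtain i X Y where s': "s = (i, X, Y)" by (metis prod_cases3)
  obtain i' X' Y' where t': "t = (i', X', Y')" by (metis prod_cases3)
  have fin: "finite X" "finite X'" "finite Y" "finite Y'" "card X = card X'"
    using s t unfolding s' t' skew_choices_def
    by (auto intro: finite_subset[OF _ finite_larger_left] finite_subset[OF _ finite_smaller_right])
  have "sorted_list_of_set X = sorted_list_of_set X' \<and> i = i' \<and>
      sorted_list_of_set Y = sorted_list_of_set Y'"
    using eq fin by (simp add: s' t' index_list_def)
  then show "s = t"
    using fin s' t' by (metis set_sorted_list_of_set)
qed

lemma perm_at_inj_on:
  assumes "w \<in> perms"
  shows "inj_on (perm_at w) {1..length w}"
  using assms by (auto simp: inj_on_def perm_at_def perms_iff nth_eq_iff_index_eq)

lemma perm_at_image: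
  assumes "w \<in> perms"
  shows "perm_at w ` {1..length w} = {1..length w}"
proof -
  have "perm_at w ` {1..length w} = (!) w ` {..<length w}"
  proof -
    have "{1..length w} = Suc ` {..<length w}"
      by (simp add: image_Suc_lessThan)
    then show ?thesis
      by (simp only: image_image) (auto simp: perm_at_def intro!: image_cong)
  qed
  also have "\<dots> = set w" by (auto simp: set_conv_nth)
  also have "\<dots> = {1..length w}" using assms by (simp add: perms_iff)
  finally show ?thesis .
qed

lemma order_isomorphic_middle:
  assumes iso: "order_isomorphic (x @ v # y) (x' @ v' # y')"
    and len: "length x = length x'"
    and "\<And>z. z \<in> set x' \<Longrightarrow> v' < z" "\<And>z. z \<in> set y' \<Longrightarrow> z < v'"
  shows "(\<forall>z \<in> set x. v < z) \<and> (\<forall>z \<in> set y. z < v)"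
proof -
  let ?u = "x @ v # y" and ?u' = "x' @ v' # y'"
  have cmp: "?u ! i < ?u ! j \<longleftrightarrow> ?u' ! i < ?u' ! j" if "i < length ?u" "j < length ?u" for i j
    using iso that by (simp add: order_isomorphic_def)
  have leny: "length y = length y'"
    using iso len by (simp add: order_isomorphic_def)
  show ?thesis
  proof (intro conjI ballI)
    fix z assume "z \<in> set x"
    then obtain t where t: "t < length x" "z = x ! t" by (auto simp: in_set_conv_nth)
    then show "v < z"
      using cmp[of "length x" t] len assms(3)[of "x' ! t"] by (simp add: nth_append)
  next
    fix z assume "z \<in> set y"
    then obtain t where t: "t < length y" "z = y ! t" by (auto simp: in_set_conv_nth)
    then show "z < v"
      using cmp[of "length x + Suc t" "length x"] len leny assms(4)[of "y' ! t"]
      by (simp add: nth_append)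
  qed
qed

text \<open>
  One direction reads off the patterns \<open>q\<close> and \<open>p\<close> as the standardizations of the two outer
  parts of a choice; the other cuts an occurrence at its entry number \<open>b\<close> (counted from 0).
\<close>

lemma UN_occurrences_skew:
  assumes w: "w \<in> perms"
  shows "(\<Union>(p, q) \<in> permutations_of_set {1..a} \<times> permutations_of_set {1..b}.
            occurrences (q \<ominus> [1] \<ominus> p) w) = index_list ` skew_choices w b a"
    (is "?U = _")
proof (intro equalityI subsetI)
  fix l assume "l \<in> ?U"
  then obtain p q where p: "p \<in> perms" "length p = a" and q: "q \<in> perms" "length q = b"
    and l: "sorted_wrt (<) l" "set l \<subseteq> {1..length w}"
    and iso: "order_isomorphic (map (perm_at w) l) (q \<ominus> [1] \<ominus> p)"
    by (auto simp del: One_nat_def simp: mem_permutations_iff occurrences_def)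
  have len: "length l = b + 1 + a"
    using iso p q by (simp add: order_isomorphic_def)
  define xs i ys where "xs = take b l" and "i = l ! b" and "ys = drop (Suc b) l"
  have split: "l = xs @ i # ys" and lens: "length xs = b" "length ys = a"
    using len id_take_nth_drop[of b l] by (auto simp: xs_def i_def ys_def)
  have "order_isomorphic (map (perm_at w) xs @ perm_at w i # map (perm_at w) ys)
          (map (\<lambda>x. Suc a + x) q @ (a + 1) # p)"
    using iso p q by (simp add: split skew_sum_def comp_def add.assoc)
  moreover have "z < a + 1" if "z \<in> set p" for z
    using p that by (auto simp: perms_iff)
  moreover have "a + 1 < z" if "z \<in> set (map (\<lambda>x. Suc a + x) q)" for z
    using q that by (auto simp: perms_iff)
  ultimately have cmp: "\<forall>j \<in> set xs. perm_at w i < perm_at w j"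
      "\<forall>j \<in> set ys. perm_at w j < perm_at w i"
    using order_isomorphic_middle[of "map (perm_at w) xs" "perm_at w i" "map (perm_at w) ys"
        "map (\<lambda>x. Suc a + x) q" "a + 1" p] p q lens by auto
  have srt: "sorted_wrt (<) xs" "sorted_wrt (<) ys"
      "\<forall>j \<in> set xs. j < i" "\<forall>j \<in> set ys. i < j"
    using l(1) by (auto simp: split sorted_wrt_append)
  have "set xs \<subseteq> larger_left w i" "set ys \<subseteq> smaller_right w i" "i \<in> {1..length w}"
    using cmp srt(3,4) l(2) by (auto simp: split larger_left_def smaller_right_def)
  moreover have "distinct xs" "distinct ys"
      "sorted_list_of_set (set xs) = xs" "sorted_list_of_set (set ys) = ys"
    using srt(1,2) by (auto simp: strict_sorted_iff sorted_list_of_set.idem_if_sorted_distinct)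
  ultimately have "(i, set xs, set ys) \<in> skew_choices w b a"
      "index_list (i, set xs, set ys) = l"
    by (auto simp: skew_choices_def index_list_def split distinct_card lens)
  then show "l \<in> index_list ` skew_choices w b a" by force
next
  fix l assume "l \<in> index_list ` skew_choices w b a"
  then obtain i X Y where i: "i \<in> {1..length w}"
    and X: "X \<subseteq> larger_left w i" "card X = b"
    and Y: "Y \<subseteq> smaller_right w i" "card Y = a"
    and l: "l = sorted_list_of_set X @ i # sorted_list_of_set Y"
    by (auto simp: skew_choices_def index_list_def)
  have fin: "finite X" "finite Y"
    using X(1) Y(1) by (auto intro: finite_subset[OF _ finite_larger_left]
        finite_subset[OF _ finite_smaller_right])
  have srt: "sorted_wrt (<) l"
    using X(1) Y(1) fin
    by (fastforce simp: l sorted_wrt_append larger_left_def smaller_right_def)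
  have sub: "set l \<subseteq> {1..length w}"
    using X(1) Y(1) fin i by (auto simp: l larger_left_def smaller_right_def)
  define x y where "x = map (perm_at w) (sorted_list_of_set X)"
    and "y = map (perm_at w) (sorted_list_of_set Y)"
  have dist: "distinct (map (perm_at w) l)"
    using srt sub perm_at_inj_on[OF w]
    by (auto simp: distinct_map strict_sorted_iff intro: inj_on_subset)
  have xy: "map (perm_at w) l = (x @ [perm_at w i]) @ y"
    by (simp add: l x_def y_def)
  have gt: "perm_at w i < z" if "z \<in> set x" for z
    using that X(1) fin by (auto simp: x_def larger_left_def)
  have lt: "z < perm_at w i" if "z \<in> set y" for z
    using that Y(1) fin by (auto simp: y_def smaller_right_def)
  have "std (map (perm_at w) l) = std (x @ [perm_at w i]) \<ominus> std y"
    unfolding xy by (rule std_append) (use gt lt in \<open>auto intro: less_trans\<close>)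
  also have "std (x @ [perm_at w i]) = std x \<ominus> [1]"
    using std_append[of x "[perm_at w i]"] gt by simp
  finally have "order_isomorphic (map (perm_at w) l) (std x \<ominus> [1] \<ominus> std y)"
    by (metis order_isomorphic_std)
  then have "l \<in> occurrences (std x \<ominus> [1] \<ominus> std y) w"
    using srt sub by (simp add: occurrences_def)
  moreover have "std x \<in> permutations_of_set {1..b}" "std y \<in> permutations_of_set {1..a}"
    using dist X Y by (auto simp del: One_nat_def simp: xy mem_permutations_iff x_def y_def intro!: std_in_perms)
  ultimately show "l \<in> ?U" by blast
qed

lemma finite_occurrences [simp]: "finite (occurrences p w)"
proof (rule finite_subset)
  show "occurrences p w \<subseteq> {l. set l \<subseteq> {1..length w} \<and> length l = length p}"
    by (auto simp: occurrences_def order_isomorphic_def)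
qed (simp add: finite_lists_length_eq)

lemma occurrences_disjoint:
  assumes "p \<in> perms" "p' \<in> perms" "p \<noteq> p'"
  shows "occurrences p w \<inter> occurrences p' w = {}"
  using assms by (auto simp: occurrences_def order_isomorphic_perm_iff)

lemma sum_pattern_count_skew:
  assumes w: "w \<in> perms"
  shows "(\<Sum>(p, q) \<in> permutations_of_set {1..a} \<times> permutations_of_set {1..b}.
            pattern_count (q \<ominus> [1] \<ominus> p) w) =
         (\<Sum>i=1..length w.
            (card (larger_left w i) choose b) * (card (smaller_right w i) choose a))"
proof -
  let ?P = "permutations_of_set {1..a} \<times> permutations_of_set {1..b}"
  let ?O = "\<lambda>(p, q). occurrences (q \<ominus> [1] \<ominus> p) w"
  have "?O s \<inter> ?O t = {}" if "s \<in> ?P" "t \<in> ?P" "s \<noteq> t" for s t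
  proof -
    obtain p q p' q' where st: "s = (p, q)" "t = (p', q')" by (metis surj_pair)
    have "q \<ominus> [1] \<ominus> p \<noteq> q' \<ominus> [1] \<ominus> p'"
      using that skew_sum_inject[of q p q' p'] by (auto simp del: One_nat_def simp: st mem_permutations_iff)
    moreover have "q \<ominus> [1] \<ominus> p \<in> perms" "q' \<ominus> [1] \<ominus> p' \<in> perms"
      using that by (auto simp del: One_nat_def simp: st mem_permutations_iff
          intro!: skew_sum_in_perms singleton_in_perms)
    ultimately show ?thesis using occurrences_disjoint by (simp add: st)
  qed
  then have "card (\<Union>s\<in>?P. ?O s) = (\<Sum>s\<in>?P. card (?O s))"
    by (intro card_UN_disjoint) auto
  then have "(\<Sum>(p, q) \<in> ?P. pattern_count (q \<ominus> [1] \<ominus> p) w) = card (\<Union>s\<in>?P. ?O s)"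
    by (simp add: pattern_count_def case_prod_unfold)
  also have "\<dots> = card (skew_choices w b a)"
    using UN_occurrences_skew[OF w] card_image[OF inj_index_list] by metis
  finally show ?thesis by (simp add: card_skew_choices)
qed

text \<open>
  Both \<open>w(i)\<close> and \<open>i\<close> exceed by one a count that contains the earlier positions carrying
  smaller values; these cancel in the difference.
\<close>

lemma displacement_eq:
  assumes w: "w \<in> perms" and i: "i \<in> {1..length w}"
  shows "int (perm_at w i) - int i = int (card (smaller_right w i)) - int (card (larger_left w i))"
proof -
  define C where "C = {j \<in> {1..<i}. perm_at w j < perm_at w i}"
  have fin: "finite C" by (simp add: C_def)
  note inj = perm_at_inj_on[OF w]
  have img: "perm_at w ` {1..length w} = {1..length w}" using perm_at_image[OF w] .
  have wi: "perm_at w i \<in> {1..length w}" using img i by blast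
  have ne: "perm_at w j \<noteq> perm_at w i" if "j \<in> {1..length w}" "j \<noteq> i" for j
    using inj i that by (auto dest: inj_onD)
  have "{1..<i} = C \<union> larger_left w i"
  proof -
    have "perm_at w j < perm_at w i \<or> perm_at w i < perm_at w j" if "j \<in> {1..<i}" for j
      using ne[of j] that i by auto
    then show ?thesis unfolding C_def larger_left_def by blast
  qed
  moreover have "C \<inter> larger_left w i = {}"
    by (auto simp: C_def larger_left_def)
  ultimately have 1: "i - 1 = card C + card (larger_left w i)"
    using card_Un_disjoint[OF fin finite_larger_left[of w i]] by (metis card_atLeastLessThan)
  have sub: "C \<union> smaller_right w i \<subseteq> {1..length w}"
    using i by (auto simp: C_def smaller_right_def)
  have "perm_at w ` (C \<union> smaller_right w i) = {1..<perm_at w i}"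
  proof (intro equalityI subsetI)
    fix v assume "v \<in> perm_at w ` (C \<union> smaller_right w i)"
    then obtain j where j: "j \<in> C \<union> smaller_right w i" "v = perm_at w j" by blast
    then have "v \<in> {1..length w}" using sub img by blast
    moreover have "v < perm_at w i" using j by (auto simp: C_def smaller_right_def)
    ultimately show "v \<in> {1..<perm_at w i}" by simp
  next
    fix v assume v: "v \<in> {1..<perm_at w i}"
    then have "v \<in> perm_at w ` {1..length w}" using wi img by auto
    then obtain j where j: "j \<in> {1..length w}" "v = perm_at w j" by blast
    then have "j \<noteq> i" using v by auto
    then have "j \<in> C \<union> smaller_right w i"
      using j v by (auto simp: C_def smaller_right_def)
    then show "v \<in> perm_at w ` (C \<union> smaller_right w i)" using j by blast
  qed
  then have "perm_at w i - 1 = card (C \<union> smaller_right w i)"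
    using card_image[OF inj_on_subset[OF inj sub]] by (metis card_atLeastLessThan)
  also have "\<dots> = card C + card (smaller_right w i)"
    by (intro card_Un_disjoint fin) (auto simp: C_def smaller_right_def)
  finally have 2: "perm_at w i - 1 = card C + card (smaller_right w i)" .
  show ?thesis using 1 2 i wi by auto
qed

section \<open>The binomial identity\<close>

text \<open>
  For \<open>b = 0 = k\<close> the last factor is \<open>-1 gchoose 0 = 1\<close>, which is why the upper index \<open>k - 1\<close>
  has to be taken in the ring.
\<close>

lemma gbinomial_uminus_expansion:
  fixes y :: "'a::field_char_0"
  shows "(- y) gchoose k =
    (-1) ^ k * (\<Sum>b\<le>k. (y gchoose b) * ((of_nat k - 1) gchoose (k - b)))"
proof -
  have "(- y) gchoose k = (-1) ^ k * ((y + (of_nat k - 1)) gchoose k)"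
    by (subst gbinomial_negated_upper) (simp add: algebra_simps)
  then show ?thesis
    by (simp add: gbinomial_Vandermonde flip: atLeast0AtMost)
qed

lemma gbinomial_diff_expansion:
  fixes x y c :: "'a::field_char_0"
  shows "(x - y + c) gchoose m =
    (\<Sum>(a, b) | a + b \<le> m.
       (\<Sum>k | b \<le> k \<and> k + a \<le> m.
          (-1) ^ k * (c gchoose (m - a - k)) * ((of_nat k - 1) gchoose (k - b))) *
       ((x gchoose a) * (y gchoose b)))"
proof -
  let ?t = "\<lambda>a b k. (-1) ^ k * (c gchoose (m - a - k)) * ((of_nat k - 1) gchoose (k - b))"
  have inner: "(- y + c) gchoose (m - a) =
      (\<Sum>b\<le>m - a. (\<Sum>k | b \<le> k \<and> k + a \<le> m. ?t a b k) * (y gchoose b))"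
    if "a \<le> m" for a
  proof -
    have "(- y + c) gchoose (m - a) =
        (\<Sum>k\<le>m - a. ((- y) gchoose k) * (c gchoose (m - a - k)))"
      by (simp only: gbinomial_Vandermonde atLeast0AtMost[symmetric])
    also have "\<dots> = (\<Sum>k\<le>m - a. \<Sum>b | b \<in> {..m - a} \<and> b \<le> k. ?t a b k * (y gchoose b))"
    proof (intro sum.cong refl)
      fix k assume "k \<in> {..m - a}"
      then have "{b. b \<in> {..m - a} \<and> b \<le> k} = {..k}" by auto
      then show "((- y) gchoose k) * (c gchoose (m - a - k)) =
          (\<Sum>b | b \<in> {..m - a} \<and> b \<le> k. ?t a b k * (y gchoose b))"
        by (simp add: gbinomial_uminus_expansion sum_distrib_left sum_distrib_right mult_ac)
    qed
    also have "\<dots> = (\<Sum>b\<le>m - a. \<Sum>k | k \<in> {..m - a} \<and> b \<le> k. ?t a b k * (y gchoose b))"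
      by (rule sum.swap_restrict) auto
    also have "\<dots> = (\<Sum>b\<le>m - a. (\<Sum>k | b \<le> k \<and> k + a \<le> m. ?t a b k) * (y gchoose b))"
    proof (intro sum.cong refl)
      fix b
      have "{k. k \<in> {..m - a} \<and> b \<le> k} = {k. b \<le> k \<and> k + a \<le> m}"
        using that by auto
      then show "(\<Sum>k | k \<in> {..m - a} \<and> b \<le> k. ?t a b k * (y gchoose b)) =
          (\<Sum>k | b \<le> k \<and> k + a \<le> m. ?t a b k) * (y gchoose b)"
        by (simp add: sum_distrib_right)
    qed
    finally show ?thesis .
  qed
  have "(x - y + c) gchoose m = (\<Sum>a\<le>m. (x gchoose a) * ((- y + c) gchoose (m - a)))"
    using gbinomial_Vandermonde[of x "- y + c" m] by (simp add: atLeast0AtMost add_diff_eq diff_add_eq)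
  also have "\<dots> = (\<Sum>a\<le>m. \<Sum>b\<le>m - a. (\<Sum>k | b \<le> k \<and> k + a \<le> m. ?t a b k) *
      ((x gchoose a) * (y gchoose b)))"
    by (intro sum.cong refl) (simp only: atMost_iff inner sum_distrib_left mult_ac)
  also have "\<dots> = (\<Sum>(a, b) \<in> (SIGMA a:{..m}. {..m - a}).
      (\<Sum>k | b \<le> k \<and> k + a \<le> m. ?t a b k) * ((x gchoose a) * (y gchoose b)))"
    by (simp add: sum.Sigma)
  also have "(SIGMA a:{..m}. {..m - a}) = {(a, b). a + b \<le> m}" by auto
  finally show ?thesis .
qed

section \<open>Expansion of the moments\<close>

lemma moment_term_eq:
  assumes "w \<in> perms" "i \<in> {1..length w}"
  shows "moment_term m w i =
    (\<Sum>(a, b) | a + b \<le> m. kappa m a b *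
       of_nat ((card (larger_left w i) choose b) * (card (smaller_right w i) choose a)))"
proof -
  have "moment_term m w i = (of_nat (card (smaller_right w i)) - of_nat (card (larger_left w i))
      + rat_of_int (\<lceil>real m / 2\<rceil> - 1)) gchoose m"
    using displacement_eq[OF assms] by (simp add: moment_term_def add_diff_eq)
  then show ?thesis
    unfolding gbinomial_diff_expansion
    by (simp add: kappa_def mult_ac flip: binomial_gbinomial)
qed

text \<open>Beyond the length of \<open>w\<close> the upper index is \<open>\<lceil>m/2\<rceil> - 1\<close>, a natural number below \<open>m\<close>.\<close>

lemma moment_term_eq_0:
  assumes "1 \<le> m" "length w < i"
  shows "moment_term m w i = 0"
proof -
  define k where "k = nat (\<lceil>real m / 2\<rceil> - 1)"
  have k: "\<lceil>real m / 2\<rceil> - 1 = int k" "k < m"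
    using assms(1) unfolding k_def by linarith+
  have "rat_of_nat k gchoose m = 0"
    using k(2) by (simp flip: binomial_gbinomial)
  then show ?thesis
    using assms(2) k(1) by (simp add: moment_term_def perm_at_def)
qed

lemma binomial_moment_eq_sum:
  assumes "1 \<le> m"
  shows "binomial_moment m w = (\<Sum>i=1..length w. moment_term m w i)"
  unfolding binomial_moment_def
proof (rule sum.mono_neutral_left)
  show "{i. 1 \<le> i \<and> moment_term m w i \<noteq> 0} \<subseteq> {1..length w}"
    using moment_term_eq_0[OF assms] by (force simp: not_less[symmetric])
qed auto

abbreviation (input) pattern_pairs :: "nat \<Rightarrow> (nat list \<times> nat list) set" where
  "pattern_pairs m \<equiv> {(p, q). p \<in> perms \<and> q \<in> perms \<and> length p + length q \<le> m}"

lemma pattern_pairs_eq: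
  "pattern_pairs m = (\<Union>(a, b) \<in> {(a, b). a + b \<le> m}.
     permutations_of_set {1..a} \<times> permutations_of_set {1..b})"
  by (auto simp del: One_nat_def simp: mem_permutations_iff)

lemma finite_pairs_le [simp]: "finite {(a :: nat, b). a + b \<le> m}"
  by (rule finite_subset[of _ "{..m} \<times> {..m}"]) auto

lemma finite_pattern_pairs [simp]: "finite (pattern_pairs m)"
  unfolding pattern_pairs_eq by (intro finite_UN_I finite_pairs_le) auto

lemma binomial_moment_expansion:
  assumes m: "1 \<le> m" and w: "w \<in> perms"
  shows "binomial_moment m w = (\<Sum>(p, q) \<in> pattern_pairs m.
     kappa m (length p) (length q) * of_nat (pattern_count (q \<ominus> [1] \<ominus> p) w))"
proof -
  let ?S = "{(a :: nat, b). a + b \<le> m}"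
  let ?P = "\<lambda>(a, b). permutations_of_set {1..a::nat} \<times> permutations_of_set {1..b::nat}"
  let ?f = "\<lambda>(p, q). kappa m (length p) (length q) * of_nat (pattern_count (q \<ominus> [1] \<ominus> p) w)"
  have "(\<Sum>s\<in>pattern_pairs m. ?f s) = (\<Sum>s\<in>?S. \<Sum>t\<in>?P s. ?f t)"
    unfolding pattern_pairs_eq
    by (rule sum.UNION_disjoint) (auto simp del: One_nat_def simp: mem_permutations_iff)
  also have "\<dots> = (\<Sum>(a, b)\<in>?S. kappa m a b * of_nat (\<Sum>(p, q)\<in>?P (a, b).
      pattern_count (q \<ominus> [1] \<ominus> p) w))"
    by (auto simp del: One_nat_def simp: sum_distrib_left mem_permutations_iff intro!: sum.cong)
  also have "\<dots> = (\<Sum>(a, b)\<in>?S. kappa m a b * of_nat (\<Sum>i=1..length w.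
      (card (larger_left w i) choose b) * (card (smaller_right w i) choose a)))"
    using sum_pattern_count_skew[OF w] by simp
  also have "\<dots> = (\<Sum>i=1..length w. \<Sum>(a, b)\<in>?S. kappa m a b * of_nat
      ((card (larger_left w i) choose b) * (card (smaller_right w i) choose a)))"
    by (subst sum.swap) (simp add: case_prod_unfold sum_distrib_left)
  also have "\<dots> = binomial_moment m w"
    unfolding binomial_moment_eq_sum[OF m] using moment_term_eq[OF w] by simp
  finally show ?thesis by simp
qed

section \<open>Collecting equal patterns\<close>

lemma pattern_count_eq_0:
  assumes "length w < length p"
  shows "pattern_count p w = 0"
proof -
  have "length l \<le> length w" if "sorted_wrt (<) l" "set l \<subseteq> {1..length w}" for l
    using that card_mono[OF _ that(2)] distinct_card[of l] by (simp add: strict_sorted_iff)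
  then have "occurrences p w = {}"
    using assms by (force simp: occurrences_def order_isomorphic_def)
  then show ?thesis by (simp add: pattern_count_def)
qed

lemma finite_perms_length_le: "finite {p \<in> perms. length p \<le> n}"
proof -
  have "{p \<in> perms. length p \<le> n} = (\<Union>k\<le>n. permutations_of_set {1..k})"
    by (auto simp del: One_nat_def simp: mem_permutations_iff)
  then show ?thesis by simp
qed

text \<open>
  A finite combination \<open>(\<Sum>s\<in>S. g s * [h s])\<close> may repeat patterns; the coefficient of a pattern
  is the sum of \<open>g\<close> over its fibre under \<open>h\<close>.
\<close>

lemma pattern_finiteI:
  assumes S: "finite S" and h: "h ` S \<subseteq> perms"
    and f: "\<And>w. w \<in> perms \<Longrightarrow> f w = (\<Sum>s\<in>S. g s * of_nat (pattern_count (h s) w))"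
  shows "pattern_finite f"
  unfolding pattern_finite_def
proof (intro exI conjI)
  let ?c = "\<lambda>r. \<Sum>s | s \<in> S \<and> h s = r. g s"
  have "?c r = 0" if "r \<notin> h ` S" for r
  proof -
    have "{s. s \<in> S \<and> h s = r} = {}" using that by auto
    then show ?thesis by (metis sum.empty)
  qed
  then have "{r \<in> perms. ?c r \<noteq> 0} \<subseteq> h ` S" by blast
  then show "finite {r \<in> perms. ?c r \<noteq> 0}"
    using S by (meson finite_imageI finite_subset)
  show "pattern_expansion ?c f"
    unfolding pattern_expansion_def
  proof
    fix w assume w: "w \<in> perms"
    let ?R = "{r. r \<in> perms \<and> length r \<le> length w}"
    let ?S = "{s \<in> S. h s \<in> ?R}"
    let ?F = "\<lambda>s. g s * of_nat (pattern_count (h s) w)"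
    have "f w = (\<Sum>s\<in>S. ?F s)" by (rule f[OF w])
    also have "\<dots> = (\<Sum>s\<in>?S. ?F s)"
    proof (rule sum.mono_neutral_right[OF S])
      show "\<forall>s \<in> S - ?S. ?F s = 0"
        using h by (auto simp: not_le intro!: pattern_count_eq_0)
    qed auto
    also have "\<dots> = (\<Sum>r\<in>?R. \<Sum>s | s \<in> ?S \<and> h s = r. ?F s)"
      by (rule sum.group[symmetric]) (use S finite_perms_length_le in auto)
    also have "\<dots> = (\<Sum>r\<in>?R. ?c r * of_nat (pattern_count r w))"
    proof (rule sum.cong[OF refl])
      fix r assume "r \<in> ?R"
      then have "{s. s \<in> ?S \<and> h s = r} = {s. s \<in> S \<and> h s = r}" by auto
      then show "(\<Sum>s | s \<in> ?S \<and> h s = r. ?F s) = ?c r * of_nat (pattern_count r w)"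
        by (simp add: sum_distrib_right)
    qed
    finally show "f w = (\<Sum>r\<in>?R. ?c r * of_nat (pattern_count r w))" .
  qed
qed

theorem proposition3p11:
  fixes m :: nat
  assumes "1 \<le> m"
  shows "pattern_finite (binomial_moment m) \<and>
    (\<forall>w \<in> perms. binomial_moment m w =
       (\<Sum>(p, q) | p \<in> perms \<and> q \<in> perms \<and> length p + length q \<le> m.
          kappa m (length p) (length q) * of_nat (pattern_count (q \<ominus> [1] \<ominus> p) w)))"
proof (intro conjI ballI)
  show "pattern_finite (binomial_moment m)"
  proof (rule pattern_finiteI[OF finite_pattern_pairs])
    show "(\<lambda>(p, q). q \<ominus> [1] \<ominus> p) ` pattern_pairs m \<subseteq> perms"
      by (auto simp del: One_nat_def intro!: skew_sum_in_perms singleton_in_perms)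
    show "binomial_moment m w = (\<Sum>s \<in> pattern_pairs m.
        (case s of (p, q) \<Rightarrow> kappa m (length p) (length q)) *
        of_nat (pattern_count (case s of (p, q) \<Rightarrow> q \<ominus> [1] \<ominus> p) w))" if "w \<in> perms" for w
      unfolding binomial_moment_expansion[OF assms that] by (simp add: case_prod_unfold)
  qed
next
  fix w assume "w \<in> perms"
  then show "binomial_moment m w =
      (\<Sum>(p, q) | p \<in> perms \<and> q \<in> perms \<and> length p + length q \<le> m.
         kappa m (length p) (length q) * of_nat (pattern_count (q \<ominus> [1] \<ominus> p) w))"
    by (rule binomial_moment_expansion[OF assms])
qed

end
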